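(* Let $G$ be a finite group acting unitarily on the $d$-dimensional real inner product space $\mathcal{V}$, and let $w=(w_1,\dots,w_p)\in\mathcal{V}^p$. Suppose the max filter bank embedding $\widehat{\Phi}_{w,S_{\max}}:\widehat{\mathcal{V}}\to\mathbb{R}^p$ defined by $$\widehat{\Phi}_{w,S_{\max}}([x])=\Big(\max_{g\in G}\langle x,U_gw_k\rangle\Big)_{k\in[p]}$$ is injective. Then $\widehat{\Phi}_{w,S_{\max}}$ is bi-Lipschitz, that is, there are $0<a\le b<\infty$ such that for every $x,y\in\mathcal{V}$, $$a\,\mathbf{d}([x],[y])\le\|\Phi_{w,S_{\max}}(x)-\Phi_{w,S_{\max}}(y)\|_2\le b\,\mathbf{d}([x],[y]),$$ where $\Phi_{w,S_{\max}}(x)=\widehat{\Phi}_{w,S_{\max}}([x])$.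
   Context: $(\mathcal{V},\langle\cdot,\cdot\rangle)$ is a real inner product space of finite dimension $d\ge 2$. $G$ is a finite group acting unitarily on $\mathcal{V}$: $g\mapsto U_g$ is a homomorphism into the group of linear isometries of $\mathcal{V}$ (so $g\cdot w=U_gw$). The orbit of $x$ is $[x]=\{U_gx:g\in G\}$, $\widehat{\mathcal{V}}=\mathcal{V}/G$ is the set of orbits, with metric $\mathbf{d}([x],[y])=\min_{g\in G}\|x-U_gy\|$. $[p]=\{1,\dots,p\}$. *)

theory Defs
  imports "HOL-Analysis.Analysis" "HOL-Algebra.Group_Action"
begin

definition orthogonal_group :: "('v::euclidean_space \<Rightarrow> 'v) monoid" where
  "orthogonal_group =
     \<lparr>carrier = {f. orthogonal_transformation f}, mult = (\<circ>), one = id\<rparr>"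

lemma group_orthogonal_group: "group (orthogonal_group :: ('v::euclidean_space \<Rightarrow> 'v) monoid)"
proof (rule groupI)
  fix f :: "'v \<Rightarrow> 'v"
  assume "f \<in> carrier orthogonal_group"
  then have f: "orthogonal_transformation f"
    by (simp add: orthogonal_group_def)
  then have "orthogonal_transformation (inv_into UNIV f)" "inv_into UNIV f \<circ> f = id"
    using orthogonal_transformation_inj[OF f]
    by (auto simp: orthogonal_transformation_inv)
  then show "\<exists>h\<in>carrier orthogonal_group. h \<otimes>\<^bsub>orthogonal_group\<^esub> f = \<one>\<^bsub>orthogonal_group\<^esub>"
    by (auto simp: orthogonal_group_def)
qed (auto simp: orthogonal_group_def comp_assoc orthogonal_transformation_def linear_compose
      linear_id)

definition max_filter_bank ::
    "('g, 'm) monoid_scheme \<Rightarrow> ('g \<Rightarrow> 'v \<Rightarrow> 'v) \<Rightarrow> 'v ^ 'p \<Rightarrow> 'v::euclidean_space \<Rightarrow> real ^ 'p" where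
  "max_filter_bank G U w x = (\<chi> k. Max ((\<lambda>g. x \<bullet> U g (w $ k)) ` carrier G))"

text \<open>The two notions below live on the orbit space.  They are given by a formula in
  representatives; \<^const>\<open>the_elem\<close> extracts the value common to all representatives, and the
  lemmas at the end show that this value exists for an orthogonal action of a finite group.\<close>

definition max_filter_bank_hat ::
    "('g, 'm) monoid_scheme \<Rightarrow> ('g \<Rightarrow> 'v \<Rightarrow> 'v) \<Rightarrow> 'v ^ 'p \<Rightarrow> 'v::euclidean_space set \<Rightarrow> real ^ 'p" where
  "max_filter_bank_hat G U w X = the_elem (max_filter_bank G U w ` X)"

definition orbit_dist ::
    "('g, 'm) monoid_scheme \<Rightarrow> ('g \<Rightarrow> 'v \<Rightarrow> 'v) \<Rightarrow> 'v::euclidean_space set \<Rightarrow> 'v set \<Rightarrow> real" where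
  "orbit_dist G U X Y =
     the_elem ((\<lambda>(x, y). Min ((\<lambda>g. norm (x - U g y)) ` carrier G)) ` (X \<times> Y))"

context
  fixes G :: "('g, 'm) monoid_scheme" and U :: "'g \<Rightarrow> 'v::euclidean_space \<Rightarrow> 'v"
  assumes hom: "group_hom G orthogonal_group U"
begin

interpretation group_hom G "orthogonal_group :: ('v \<Rightarrow> 'v) monoid" U
  by (rule hom)

private lemma U_orth: "g \<in> carrier G \<Longrightarrow> orthogonal_transformation (U g)"
  using hom_closed[of g] by (simp add: orthogonal_group_def)

private lemma U_mult:
  "g \<in> carrier G \<Longrightarrow> h \<in> carrier G \<Longrightarrow> U (g \<otimes>\<^bsub>G\<^esub> h) x = U g (U h x)"
  using hom_mult[of g h] by (simp add: orthogonal_group_def)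

private lemma U_one: "U \<one>\<^bsub>G\<^esub> x = x"
  using hom_one by (simp add: orthogonal_group_def)

private lemma U_inv: "g \<in> carrier G \<Longrightarrow> U g (U (inv\<^bsub>G\<^esub> g) x) = x"
  using U_mult[of g "inv\<^bsub>G\<^esub> g" x] U_one by simp

private lemma orbit_refl: "x \<in> orbit G U x"
  unfolding orbit_def using U_one[of x] G.one_closed by force

private lemma translate_left: "h \<in> carrier G \<Longrightarrow> (\<lambda>g. h \<otimes>\<^bsub>G\<^esub> g) ` carrier G = carrier G"
  by (simp add: G.surj_const_mult)

private lemma translate_right:
  assumes "h \<in> carrier G" shows "(\<lambda>g. g \<otimes>\<^bsub>G\<^esub> h) ` carrier G = carrier G"
proof (intro equalityI subsetI)
  fix g assume g: "g \<in> carrier G"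
  then have "g = (g \<otimes>\<^bsub>G\<^esub> inv\<^bsub>G\<^esub> h) \<otimes>\<^bsub>G\<^esub> h"
    using assms by (simp add: G.m_assoc)
  then show "g \<in> (\<lambda>g. g \<otimes>\<^bsub>G\<^esub> h) ` carrier G"
    using g assms by blast
qed (use assms in auto)

private lemma max_filter_bank_invariant:
  assumes h: "h \<in> carrier G"
  shows "max_filter_bank G U w (U h x) = max_filter_bank G U w x"
proof -
  have "(\<lambda>g. U h x \<bullet> U g v) ` carrier G = (\<lambda>g. x \<bullet> U g v) ` carrier G" for v
  proof -
    have "(\<lambda>g. U h x \<bullet> U g v) ` carrier G = (\<lambda>g. U h x \<bullet> U g v) ` (\<lambda>g. h \<otimes>\<^bsub>G\<^esub> g) ` carrier G"
      by (simp add: translate_left h)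
    also have "\<dots> = (\<lambda>g. x \<bullet> U g v) ` carrier G"
      unfolding image_image
      by (rule image_cong) (use U_orth[OF h] h in \<open>auto simp: U_mult orthogonal_transformation_def simp del: hom_mult\<close>)
    finally show ?thesis .
  qed
  then show ?thesis
    by (simp add: max_filter_bank_def)
qed

lemma max_filter_bank_hat_orbit:
  "max_filter_bank_hat G U w (orbit G U x) = max_filter_bank G U w x"
proof -
  have "max_filter_bank G U w ` orbit G U x = {max_filter_bank G U w x}"
    using orbit_refl[of x] max_filter_bank_invariant by (auto simp: orbit_def)
  then show ?thesis
    by (simp add: max_filter_bank_hat_def)
qed

lemma orbit_dist_orbit:
  "orbit_dist G U (orbit G U x) (orbit G U y) = Min ((\<lambda>g. norm (x - U g y)) ` carrier G)"
proof -
  define f where "f x y = (\<lambda>g. norm (x - U g y)) ` carrier G" for x y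
  have left: "f (U h x) y = f x y" if h: "h \<in> carrier G" for h x y
  proof -
    have "f (U h x) y = (\<lambda>g. norm (U h x - U g y)) ` (\<lambda>g. h \<otimes>\<^bsub>G\<^esub> g) ` carrier G"
      by (simp add: f_def translate_left h)
    also have "\<dots> = f x y"
      unfolding image_image f_def
    proof (rule image_cong)
      fix g assume "g \<in> carrier G"
      then have "U h x - U (h \<otimes>\<^bsub>G\<^esub> g) y = U h (x - U g y)"
        using U_orth[OF h] h by (simp add: U_mult linear_diff orthogonal_transformation_linear del: hom_mult)
      then show "norm (U h x - U (h \<otimes>\<^bsub>G\<^esub> g) y) = norm (x - U g y)"
        using U_orth[OF h] by (simp add: orthogonal_transformation_norm)
    qed simp
    finally show ?thesis .
  qed
  have right: "f x (U h y) = f x y" if h: "h \<in> carrier G" for h x y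
  proof -
    have "f x (U h y) = (\<lambda>g. norm (x - U g y)) ` (\<lambda>g. g \<otimes>\<^bsub>G\<^esub> h) ` carrier G"
      unfolding image_image f_def by (rule image_cong) (use h in \<open>auto simp: U_mult simp del: hom_mult\<close>)
    then show ?thesis
      by (simp add: f_def translate_right h)
  qed
  have "Min (f x' y') = Min (f x y)" if "x' \<in> orbit G U x" "y' \<in> orbit G U y" for x' y'
    using that left right by (auto simp: orbit_def)
  then have "(\<lambda>p. case p of (x', y') \<Rightarrow> Min (f x' y')) ` (orbit G U x \<times> orbit G U y) = (\<lambda>_. Min (f x y)) ` (orbit G U x \<times> orbit G U y)"
    by (intro image_cong) (simp_all add: split_beta mem_Times_iff)
  also have "\<dots> = {Min (f x y)}"
    using orbit_refl[of x] orbit_refl[of y] by (subst image_constant[of "(x, y)"]) simp_all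
  finally show ?thesis
    by (simp add: orbit_dist_def f_def)
qed

end

end

theory Submission
  imports Defs
begin

text \<open>
  Write \<open>\<Phi>\<close> for the max filter bank.  It is a maximum of finitely many linear functions in
  each coordinate, so \<open>F (x, y) = \<Phi> x - \<Phi> y\<close> is piecewise linear: \<open>\<V> \<times> \<V>\<close> is a finite union
  of polyhedral cones, one for each choice of the group elements that realise the maxima, and
  \<open>F\<close> is linear on each of them.

  The lower Lipschitz bound is an instance of Hoffman's error bound for linear systems: on a
  polyhedral cone the distance from \<open>z\<close> to the solutions of \<open>L z = 0\<close> in the cone is at most
  a constant times \<open>norm (L z)\<close> (lemma \<open>hoffman_error_bound\<close>).  Taking the largest of finitely
  many constants, every \<open>(x, y)\<close> is within \<open>C * norm (F (x, y))\<close> of a zero \<open>(x', y')\<close>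
  of \<open>F\<close> (lemma \<open>piecewise_linear_error_bound\<close>).  Injectivity says that \<open>x'\<close> and \<open>y'\<close>
  lie in one orbit, \<open>x' = U g y'\<close>, and since \<open>U g\<close> is an isometry,
  \<open>norm (x - U g y) \<le> norm (x - x') + norm (y - y')\<close>.  Hence the orbit distance of \<open>x\<close>
  and \<open>y\<close> is at most \<open>2 * C * norm (\<Phi> x - \<Phi> y)\<close>.

  For the upper bound, \<open>\<Phi>\<close> is Lipschitz on \<open>\<V>\<close> and constant on orbits, so \<open>y\<close> may be
  replaced by the point of its orbit that is closest to \<open>x\<close>.
\<close>

section \<open>Error bounds on polyhedral cones\<close>

lemma convex_cone_hull_finite:
  fixes S :: "'a::real_vector set"
  assumes "finite S"
  shows "convex_cone hull S = {\<Sum>v\<in>S. c v *\<^sub>R v | c. \<forall>v\<in>S. 0 \<le> c v}"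
proof (intro equalityI subsetI)
  fix z assume "z \<in> convex_cone hull S"
  then consider "z = 0" | r h where "0 \<le> r" "h \<in> convex hull S" "z = r *\<^sub>R h"
    by (auto simp: convex_cone_hull_convex_hull)
  then show "z \<in> {\<Sum>v\<in>S. c v *\<^sub>R v | c. \<forall>v\<in>S. 0 \<le> c v}"
  proof cases
    case 1
    then show ?thesis
      by (auto intro!: exI[of _ "\<lambda>_. 0"])
  next
    case 2
    then obtain u where "\<forall>v\<in>S. 0 \<le> u v" "(\<Sum>v\<in>S. u v *\<^sub>R v) = h"
      by (auto simp: convex_hull_finite[OF assms])
    with 2 show ?thesis
      by (auto simp: scaleR_sum_right intro!: exI[of _ "\<lambda>v. r * u v"])
  qed
next
  fix z assume "z \<in> {\<Sum>v\<in>S. c v *\<^sub>R v | c. \<forall>v\<in>S. 0 \<le> c v}"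
  then obtain c where c: "\<forall>v\<in>S. 0 \<le> c v" "z = (\<Sum>v\<in>S. c v *\<^sub>R v)"
    by blast
  have "(\<Sum>v\<in>T. c v *\<^sub>R v) \<in> convex_cone hull S" if "T \<subseteq> S" for T
    using finite_subset[OF that assms] that
    by (induction T rule: finite_induct)
      (auto simp: convex_cone_hull_contains_0 c hull_inc intro!: convex_cone_hull_add convex_cone_hull_mul)
  then show "z \<in> convex_cone hull S"
    using c by blast
qed

text \<open>Cutting the cone with a box gives a bounded polyhedron, hence the convex hull of finitely
  many points; every ray of the cone meets the box in a nonzero point, so these points generate.\<close>

lemma polyhedral_cone_finitely_generated:
  fixes A :: "'a::euclidean_space set"
  assumes "finite A"
  obtains S where "finite S" "{z. \<forall>a\<in>A. a \<bullet> z \<le> 0} = convex_cone hull S"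
proof -
  define K where "K = {z. \<forall>a\<in>A. a \<bullet> z \<le> 0}"
  have K_Inter: "K = \<Inter>((\<lambda>a. {z. a \<bullet> z \<le> 0}) ` A)"
    by (auto simp: K_def)
  have cone: "convex_cone K"
    unfolding K_Inter by (intro convex_cone_Inter) (auto simp: convex_cone_halfspace_le)
  have "polyhedron K"
    unfolding K_Inter using assms by (intro polyhedron_Inter) (auto simp: polyhedron_halfspace_le)
  then have "polytope (K \<inter> cbox (- One) One)"
    by (simp add: polyhedron_Int_polytope polytope_interval)
  then obtain S where S: "finite S" "K \<inter> cbox (- One) One = convex hull S"
    by (auto simp: polytope_def)
  have "K = convex_cone hull S"
  proof (intro equalityI subsetI)
    fix z assume z: "z \<in> K"
    show "z \<in> convex_cone hull S"
    proof (cases "z = 0")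
      case False
      have "norm ((1 / norm z) *\<^sub>R z) = 1"
        using False by simp
      then have "\<bar>((1 / norm z) *\<^sub>R z) \<bullet> i\<bar> \<le> 1" if "i \<in> Basis" for i
        using Basis_le_norm[OF that, of "(1 / norm z) *\<^sub>R z"] by linarith
      then have "(1 / norm z) *\<^sub>R z \<in> cbox (- One) One"
        unfolding mem_box by (auto simp: abs_le_iff minus_le_iff simp del: inner_scaleR_left)
      moreover have "(1 / norm z) *\<^sub>R z \<in> K"
        using cone z by (simp add: convex_cone_scaleR)
      ultimately have "(1 / norm z) *\<^sub>R z \<in> convex_cone hull S"
        using S(2) convex_hull_subset_convex_cone_hull[of S] by blast
      then have "norm z *\<^sub>R ((1 / norm z) *\<^sub>R z) \<in> convex_cone hull S"
        by (rule convex_cone_hull_mul) simp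
      then show ?thesis
        using False by simp
    qed (simp add: convex_cone_hull_contains_0)
  next
    have "S \<subseteq> K"
      using S(2) hull_subset[of S convex] by blast
    then show "z \<in> K" if "z \<in> convex_cone hull S" for z
      using hull_minimal[of S K convex_cone] cone that by blast
  qed
  then show thesis
    using that S(1) by (simp add: K_def)
qed

text \<open>Induction on the set of generators.  If no convex combination of the generators lies in the
  kernel of \<open>L\<close>, then \<open>norm (L h)\<close> is bounded below on their convex hull by compactness, and
  \<open>z' = 0\<close> works.  Otherwise let \<open>k\<close> be such a combination and subtract from \<open>z\<close> the largest
  multiple \<open>s *\<^sub>R k\<close> that keeps all coefficients nonnegative.  This does not change \<open>L z\<close>,
  and one generator drops out; adding \<open>s *\<^sub>R k\<close> back to the point that the induction
  hypothesis gives for \<open>z - s *\<^sub>R k\<close> yields \<open>z'\<close>.\<close>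

lemma error_bound_finitely_generated_cone:
  fixes L :: "'a::euclidean_space \<Rightarrow> 'b::euclidean_space"
  assumes "linear L" "finite S"
  shows "\<exists>C. \<forall>z\<in>convex_cone hull S. \<exists>z'\<in>convex_cone hull S.
           L z' = 0 \<and> norm (z - z') \<le> C * norm (L z)"
  using \<open>finite S\<close>
proof (induction S rule: finite_psubset_induct)
  case (psubset S)
  interpret linear L by fact
  show ?case
  proof (cases "0 \<in> L ` (convex hull S)")
    case False
    have "compact (L ` (convex hull S))"
      using psubset.hyps \<open>linear L\<close>
      by (intro compact_continuous_image finite_imp_compact_convex_hull linear_continuous_on)
        (simp_all add: linear_conv_bounded_linear)
    then obtain \<delta> where \<delta>: "\<delta> > 0" "\<And>h. h \<in> convex hull S \<Longrightarrow> \<delta> \<le> norm (L h)"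
      using separate_point_closed[OF compact_imp_closed False] by fastforce
    obtain B where B: "\<And>h. h \<in> convex hull S \<Longrightarrow> norm h \<le> B"
      using finite_imp_compact_convex_hull[OF psubset.hyps] compact_imp_bounded bounded_iff by metis
    have "norm (z - 0) \<le> B / \<delta> * norm (L z)" if z: "z \<in> convex_cone hull S" for z
    proof -
      consider "z = 0" | r h where "0 \<le> r" "h \<in> convex hull S" "z = r *\<^sub>R h"
        using z by (auto simp: convex_cone_hull_convex_hull)
      then show ?thesis
      proof cases
        case 2
        have "norm h \<le> B / \<delta> * norm (L h)"
        proof -
          have "0 \<le> B"
            using B[OF 2(2)] norm_ge_zero[of h] by linarith
          then have "B * \<delta> \<le> B * norm (L h)"
            using \<delta>(2)[OF 2(2)] by (rule mult_left_mono[rotated])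
          then have "B \<le> B / \<delta> * norm (L h)"
            using \<delta>(1) by (simp add: field_simps)
          with B[OF 2(2)] show ?thesis by linarith
        qed
        then have "r * norm h \<le> r * (B / \<delta> * norm (L h))"
          using 2(1) by (rule mult_left_mono)
        with 2 show ?thesis by (simp add: scaleR mult_ac)
      qed (simp add: zero)
    qed
    then show ?thesis
      using convex_cone_hull_contains_0 zero by blast
  next
    case True
    then obtain t where t: "\<forall>v\<in>S. 0 \<le> t v" "sum t S = 1" "L (\<Sum>v\<in>S. t v *\<^sub>R v) = 0"
      by (auto simp: convex_hull_finite[OF psubset.hyps])
    define k where "k = (\<Sum>v\<in>S. t v *\<^sub>R v)"
    have k: "k \<in> convex_cone hull S"
      unfolding k_def convex_cone_hull_finite[OF psubset.hyps] using t(1) by blast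
    define P where "P = {v\<in>S. t v > 0}"
    have P: "finite P" "P \<noteq> {}"
    proof -
      show "finite P"
        using psubset.hyps by (simp add: P_def)
      show "P \<noteq> {}"
      proof
        assume "P = {}"
        then have "sum t S \<le> 0"
          by (intro sum_nonpos) (force simp: P_def not_less)
        then show False
          using t(2) by simp
      qed
    qed
    have "\<forall>j\<in>S. \<exists>C. \<forall>z\<in>convex_cone hull (S - {j}). \<exists>z'\<in>convex_cone hull (S - {j}).
           L z' = 0 \<and> norm (z - z') \<le> C * norm (L z)"
      using psubset.IH by blast
    then obtain C where C: "\<And>j z. j \<in> S \<Longrightarrow> z \<in> convex_cone hull (S - {j}) \<Longrightarrow>
        \<exists>z'\<in>convex_cone hull (S - {j}). L z' = 0 \<and> norm (z - z') \<le> C j * norm (L z)"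
      by metis
    have "\<exists>z'\<in>convex_cone hull S. L z' = 0 \<and> norm (z - z') \<le> Max (C ` S) * norm (L z)"
      if z: "z \<in> convex_cone hull S" for z
    proof -
      obtain c where c: "\<forall>v\<in>S. 0 \<le> c v" "z = (\<Sum>v\<in>S. c v *\<^sub>R v)"
        using z convex_cone_hull_finite[OF psubset.hyps] by auto
      \<comment> \<open>The ratio test: \<open>c j / t j\<close> is the smallest ratio, so \<open>j\<close> is the first coefficient
        to vanish.\<close>
      obtain j where j: "j \<in> P" "\<And>v. v \<in> P \<Longrightarrow> c j / t j \<le> c v / t v"
        using ex_min_if_finite[of "(\<lambda>v. c v / t v) ` P"] P by (auto simp: not_less)
      define s where "s = c j / t j"
      have jS: "j \<in> S" and tj: "t j > 0"
        using j(1) by (auto simp: P_def)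
      have s: "0 \<le> s"
        using c(1) jS tj by (simp add: s_def)
      have nonneg: "0 \<le> c v - s * t v" if "v \<in> S" for v
      proof (cases "t v > 0")
        case True
        then have "s \<le> c v / t v"
          using j(2)[of v] that by (simp add: s_def P_def)
        then show ?thesis
          using True by (simp add: field_simps)
      next
        case False
        then have "t v = 0"
          using t(1) that by force
        then show ?thesis
          using c(1) that by simp
      qed
      have "z - s *\<^sub>R k = (\<Sum>v\<in>S. (c v - s * t v) *\<^sub>R v)"
        by (simp add: c(2) k_def scaleR_sum_right sum_subtractf algebra_simps)
      also have "\<dots> = (\<Sum>v\<in>S - {j}. (c v - s * t v) *\<^sub>R v)"
        using jS tj psubset.hyps by (subst sum.remove[of S j]) (auto simp: s_def)
      finally have "z - s *\<^sub>R k \<in> convex_cone hull (S - {j})"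
        using nonneg psubset.hyps by (subst convex_cone_hull_finite) auto
      then obtain z' where z': "z' \<in> convex_cone hull (S - {j})" "L z' = 0"
          "norm (z - s *\<^sub>R k - z') \<le> C j * norm (L (z - s *\<^sub>R k))"
        using C[OF jS] by blast
      have Lk: "L k = 0"
        using t(3) by (simp add: k_def)
      have "z' + s *\<^sub>R k \<in> convex_cone hull S"
        using z'(1) hull_mono[of "S - {j}" S convex_cone] k s
        by (intro convex_cone_hull_add convex_cone_hull_mul) auto
      moreover have "L (z' + s *\<^sub>R k) = 0"
        using z'(2) Lk by (simp add: add scaleR)
      moreover have "norm (z - (z' + s *\<^sub>R k)) \<le> Max (C ` S) * norm (L z)"
      proof -
        have "norm (z - (z' + s *\<^sub>R k)) \<le> C j * norm (L z)"
          using z'(3) Lk by (simp add: diff scaleR algebra_simps)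
        also have "\<dots> \<le> Max (C ` S) * norm (L z)"
          using jS psubset.hyps by (intro mult_right_mono) auto
        finally show ?thesis .
      qed
      ultimately show ?thesis by blast
    qed
    then show ?thesis by blast
  qed
qed

lemma hoffman_error_bound:
  fixes L :: "'a::euclidean_space \<Rightarrow> 'b::euclidean_space"
  assumes "linear L" "finite A"
  shows "\<exists>C. \<forall>z. (\<forall>a\<in>A. a \<bullet> z \<le> 0) \<longrightarrow>
           (\<exists>z'. (\<forall>a\<in>A. a \<bullet> z' \<le> 0) \<and> L z' = 0 \<and> norm (z - z') \<le> C * norm (L z))"
proof -
  obtain S where "finite S" and S: "{z. \<forall>a\<in>A. a \<bullet> z \<le> 0} = convex_cone hull S"
    using polyhedral_cone_finitely_generated[OF \<open>finite A\<close>] .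
  then obtain C where C: "\<forall>z\<in>convex_cone hull S. \<exists>z'\<in>convex_cone hull S.
           L z' = 0 \<and> norm (z - z') \<le> C * norm (L z)"
    using error_bound_finitely_generated_cone[OF \<open>linear L\<close>] by blast
  show ?thesis
    using C unfolding S[symmetric] by (intro exI[of _ C]) blast
qed

text \<open>The zero \<open>z'\<close> found by Hoffman's bound stays in the cone of \<open>z\<close>, where \<open>F\<close> is given by
  the same linear map; so it is a zero of \<open>F\<close> itself.\<close>

lemma piecewise_linear_error_bound:
  fixes F :: "'a::euclidean_space \<Rightarrow> 'b::euclidean_space"
  assumes I: "finite I"
    and A: "\<And>i. i \<in> I \<Longrightarrow> finite (A i)"
    and L: "\<And>i. i \<in> I \<Longrightarrow> linear (L i)"
    and F: "\<And>i z. i \<in> I \<Longrightarrow> \<forall>a\<in>A i. a \<bullet> z \<le> 0 \<Longrightarrow> F z = L i z"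
    and cover: "\<And>z. \<exists>i\<in>I. \<forall>a\<in>A i. a \<bullet> z \<le> 0"
  obtains C where "C > 0" "\<And>z. \<exists>z'. F z' = 0 \<and> norm (z - z') \<le> C * norm (F z)"
proof -
  have "\<forall>i\<in>I. \<exists>C. \<forall>z. (\<forall>a\<in>A i. a \<bullet> z \<le> 0) \<longrightarrow>
      (\<exists>z'. (\<forall>a\<in>A i. a \<bullet> z' \<le> 0) \<and> L i z' = 0 \<and> norm (z - z') \<le> C * norm (L i z))"
    using hoffman_error_bound[OF L A] by (intro ballI)
  from bchoice[OF this] obtain C where C: "\<And>i z. i \<in> I \<Longrightarrow> \<forall>a\<in>A i. a \<bullet> z \<le> 0 \<Longrightarrow>
      \<exists>z'. (\<forall>a\<in>A i. a \<bullet> z' \<le> 0) \<and> L i z' = 0 \<and> norm (z - z') \<le> C i * norm (L i z)"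
    by blast
  define D where "D = Max (insert 1 (C ` I))"
  have "D \<ge> 1"
    using I by (simp add: D_def)
  moreover have "\<exists>z'. F z' = 0 \<and> norm (z - z') \<le> D * norm (F z)" for z
  proof -
    obtain i where i: "i \<in> I" "\<forall>a\<in>A i. a \<bullet> z \<le> 0"
      using cover by blast
    obtain z' where z': "\<forall>a\<in>A i. a \<bullet> z' \<le> 0" "L i z' = 0" "norm (z - z') \<le> C i * norm (L i z)"
      using C[OF i] by blast
    have "C i * norm (L i z) \<le> D * norm (L i z)"
      using i(1) I by (intro mult_right_mono) (auto simp: D_def)
    then show ?thesis
      using F[OF i] F[OF i(1) z'(1)] z'(2,3) by (intro exI[of _ z']) simp
  qed
  ultimately show thesis
    using that[of D] by simp
qed

section \<open>The max filter bank\<close>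

text \<open>The pieces are indexed by pairs \<open>(s, t)\<close>: on the piece of \<open>(s, t)\<close>, the group elements
  \<open>s k\<close> and \<open>t k\<close> realise the \<open>k\<close>-th maximum at \<open>x\<close> and at \<open>y\<close>.\<close>

lemma max_filter_bank_diff_error_bound:
  fixes G :: "('g, 'm) monoid_scheme" and U :: "'g \<Rightarrow> 'v::euclidean_space \<Rightarrow> 'v" and w :: "'v ^ 'p"
  assumes fin: "finite (carrier G)" and ne: "carrier G \<noteq> {}"
  obtains C where "C > 0"
    "\<And>x y. \<exists>x' y'. max_filter_bank G U w x' = max_filter_bank G U w y' \<and>
       norm ((x, y) - (x', y')) \<le> C * norm (max_filter_bank G U w x - max_filter_bank G U w y)"
proof -
  define \<Phi> where "\<Phi> = max_filter_bank G U w"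
  define I where "I = (UNIV \<rightarrow>\<^sub>E carrier G :: ('p \<Rightarrow> 'g) set) \<times> (UNIV \<rightarrow>\<^sub>E carrier G :: ('p \<Rightarrow> 'g) set)"
  define A where "A = (\<lambda>(s, t). (\<lambda>(k, g). (U g (w $ k) - U (s k) (w $ k), 0)) ` (UNIV \<times> carrier G)
      \<union> (\<lambda>(k, g). (0, U g (w $ k) - U (t k) (w $ k))) ` (UNIV \<times> carrier G) :: ('v \<times> 'v) set)"
  define L where "L = (\<lambda>(s, t) z. \<chi> k. fst z \<bullet> U (s k) (w $ k) - snd z \<bullet> U (t k) (w $ k) :: real ^ 'p)"
  have piece: "(\<forall>a\<in>A (s, t). a \<bullet> (x, y) \<le> 0) \<longleftrightarrow>
      (\<forall>k. \<forall>g\<in>carrier G. x \<bullet> U g (w $ k) \<le> x \<bullet> U (s k) (w $ k)) \<and>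
      (\<forall>k. \<forall>g\<in>carrier G. y \<bullet> U g (w $ k) \<le> y \<bullet> U (t k) (w $ k))" for s t x y
    by (auto simp: A_def ball_Un inner_diff_right inner_commute[of "_ - _"])
  have \<Phi>_eq: "\<Phi> x = (\<chi> k. x \<bullet> U (s k) (w $ k))"
    if "s \<in> UNIV \<rightarrow>\<^sub>E carrier G" "\<forall>k. \<forall>g\<in>carrier G. x \<bullet> U g (w $ k) \<le> x \<bullet> U (s k) (w $ k)" for s x
  proof -
    have "Max ((\<lambda>g. x \<bullet> U g (w $ k)) ` carrier G) = x \<bullet> U (s k) (w $ k)" for k
      using that fin by (intro Max_eqI) (auto dest!: PiE_mem[of _ _ _ k])
    then show ?thesis
      by (simp add: \<Phi>_def max_filter_bank_def)
  qed
  have maximiser: "\<exists>s\<in>UNIV \<rightarrow>\<^sub>E carrier G. \<forall>k. \<forall>g\<in>carrier G. x \<bullet> U g (w $ k) \<le> x \<bullet> U (s k) (w $ k)"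
    for x
  proof -
    have "\<exists>h\<in>carrier G. \<forall>g\<in>carrier G. x \<bullet> U g (w $ k) \<le> x \<bullet> U h (w $ k)" for k
    proof -
      have "Max ((\<lambda>g. x \<bullet> U g (w $ k)) ` carrier G) \<in> (\<lambda>g. x \<bullet> U g (w $ k)) ` carrier G"
        using fin ne by (intro Max_in) auto
      then obtain h where "h \<in> carrier G"
          "Max ((\<lambda>g. x \<bullet> U g (w $ k)) ` carrier G) = x \<bullet> U h (w $ k)"
        by blast
      then show ?thesis
        using fin by (metis Max_ge finite_imageI image_eqI)
    qed
    then obtain s where "\<And>k. s k \<in> carrier G"
        "\<And>k g. g \<in> carrier G \<Longrightarrow> x \<bullet> U g (w $ k) \<le> x \<bullet> U (s k) (w $ k)"
      by metis
    then show ?thesis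
      by (intro bexI[of _ s]) auto
  qed
  obtain C where C: "C > 0" "\<And>z. \<exists>z'. \<Phi> (fst z') - \<Phi> (snd z') = 0 \<and>
      norm (z - z') \<le> C * norm (\<Phi> (fst z) - \<Phi> (snd z))"
  proof (rule piecewise_linear_error_bound[of I A L "\<lambda>z. \<Phi> (fst z) - \<Phi> (snd z)"])
    show "finite I"
      using fin by (auto simp: I_def intro!: finite_PiE)
    show "finite (A i)" for i
      using fin by (auto simp: A_def split: prod.split)
    show "linear (L i)" for i
      by (auto simp: L_def vec_eq_iff inner_add_left algebra_simps split: prod.split intro!: linearI)
    show "\<Phi> (fst z) - \<Phi> (snd z) = L i z" if "i \<in> I" "\<forall>a\<in>A i. a \<bullet> z \<le> 0" for i z
    proof -
      obtain s t where st: "i = (s, t)" by (cases i)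
      then show ?thesis
        using that piece[of s t "fst z" "snd z"] \<Phi>_eq[of s "fst z"] \<Phi>_eq[of t "snd z"]
        by (auto simp: I_def L_def vec_eq_iff)
    qed
    show "\<exists>i\<in>I. \<forall>a\<in>A i. a \<bullet> z \<le> 0" for z
    proof -
      obtain s where s: "s \<in> UNIV \<rightarrow>\<^sub>E carrier G"
          "\<forall>k. \<forall>g\<in>carrier G. fst z \<bullet> U g (w $ k) \<le> fst z \<bullet> U (s k) (w $ k)"
        using maximiser[of "fst z"] by blast
      obtain t where t: "t \<in> UNIV \<rightarrow>\<^sub>E carrier G"
          "\<forall>k. \<forall>g\<in>carrier G. snd z \<bullet> U g (w $ k) \<le> snd z \<bullet> U (t k) (w $ k)"
        using maximiser[of "snd z"] by blast
      have "(s, t) \<in> I"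
        using s(1) t(1) by (simp add: I_def)
      moreover have "\<forall>a\<in>A (s, t). a \<bullet> z \<le> 0"
        using piece[of s t "fst z" "snd z"] s(2) t(2) by simp
      ultimately show ?thesis by blast
    qed
  qed blast
  have "\<exists>x' y'. \<Phi> x' = \<Phi> y' \<and> norm ((x, y) - (x', y')) \<le> C * norm (\<Phi> x - \<Phi> y)" for x y
    using C(2)[of "(x, y)"] by fastforce
  then show thesis
    using that C(1) by (simp add: \<Phi>_def)
qed

text \<open>Each coordinate is a maximum of linear functions \<open>x \<bullet> U g (w $ k)\<close>, all of which have
  Lipschitz constant \<open>norm (w $ k)\<close> because \<open>U g\<close> is an isometry.\<close>

lemma max_filter_bank_lipschitz:
  fixes G :: "('g, 'm) monoid_scheme" and U :: "'g \<Rightarrow> 'v::euclidean_space \<Rightarrow> 'v" and w :: "'v ^ 'p"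
  assumes fin: "finite (carrier G)" and ne: "carrier G \<noteq> {}"
    and U: "\<And>g. g \<in> carrier G \<Longrightarrow> orthogonal_transformation (U g)"
  shows "norm (max_filter_bank G U w x - max_filter_bank G U w y)
           \<le> (\<Sum>k\<in>UNIV. norm (w $ k)) * norm (x - y)"
proof -
  have le: "Max ((\<lambda>g. x \<bullet> U g v) ` carrier G) \<le> Max ((\<lambda>g. y \<bullet> U g v) ` carrier G) + norm v * norm (x - y)"
    for x y v
  proof -
    have "x \<bullet> U g v \<le> Max ((\<lambda>g. y \<bullet> U g v) ` carrier G) + norm v * norm (x - y)"
      if g: "g \<in> carrier G" for g
    proof -
      have "x \<bullet> U g v = y \<bullet> U g v + (x - y) \<bullet> U g v"
        by (simp add: inner_diff_left)
      also have "(x - y) \<bullet> U g v \<le> norm (x - y) * norm (U g v)"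
        by (rule norm_cauchy_schwarz)
      also have "norm (U g v) = norm v"
        using U[OF g] by (rule orthogonal_transformation_norm)
      also have "y \<bullet> U g v \<le> Max ((\<lambda>g. y \<bullet> U g v) ` carrier G)"
        using fin g by simp
      finally show ?thesis
        by (simp add: mult.commute)
    qed
    then show ?thesis
      using fin ne by simp
  qed
  have "\<bar>(max_filter_bank G U w x - max_filter_bank G U w y) $ k\<bar> \<le> norm (w $ k) * norm (x - y)" for k
    using le[of x "w $ k" y] le[of y "w $ k" x]
    by (simp add: max_filter_bank_def abs_le_iff norm_minus_commute)
  then have "(\<Sum>k\<in>UNIV. \<bar>(max_filter_bank G U w x - max_filter_bank G U w y) $ k\<bar>)
      \<le> (\<Sum>k\<in>UNIV. norm (w $ k) * norm (x - y))"
    by (intro sum_mono)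
  then show ?thesis
    using norm_le_l1_cart[of "max_filter_bank G U w x - max_filter_bank G U w y"]
    by (simp add: sum_distrib_right)
qed

theorem corollary1p5:
  fixes G :: "('g, 'm) monoid_scheme"
    and U :: "'g \<Rightarrow> 'v::euclidean_space \<Rightarrow> 'v"
    and w :: "'v ^ 'p"
  assumes "DIM('v) \<ge> 2"
    and "finite (carrier G)"
    and "group_hom G orthogonal_group U"
    and "inj_on (max_filter_bank_hat G U w) (orbits G UNIV U)"
  shows "\<exists>a b. 0 < a \<and> a \<le> b \<and>
    (\<forall>x y. a * orbit_dist G U (orbit G U x) (orbit G U y)
              \<le> norm (max_filter_bank G U w x - max_filter_bank G U w y)
         \<and> norm (max_filter_bank G U w x - max_filter_bank G U w y)
              \<le> b * orbit_dist G U (orbit G U x) (orbit G U y))"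
proof -
  interpret group_hom G "orthogonal_group :: ('v \<Rightarrow> 'v) monoid" U
    by fact
  note fin = \<open>finite (carrier G)\<close>
  define \<Phi> where "\<Phi> = max_filter_bank G U w"
  define d where "d x y = orbit_dist G U (orbit G U x) (orbit G U y)" for x y
  have ne: "carrier G \<noteq> {}"
    using G.one_closed by blast
  have U: "orthogonal_transformation (U g)" if "g \<in> carrier G" for g
    using hom_closed[OF that] by (simp add: orthogonal_group_def)
  have U_mult: "U (g \<otimes>\<^bsub>G\<^esub> h) x = U g (U h x)" if "g \<in> carrier G" "h \<in> carrier G" for g h x
    using hom_mult[OF that] by (simp add: orthogonal_group_def)
  have U_one: "U \<one>\<^bsub>G\<^esub> x = x" for x
    using hom_one by (simp add: orthogonal_group_def)
  have d_eq: "d x y = Min ((\<lambda>g. norm (x - U g y)) ` carrier G)" for x y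
    unfolding d_def by (rule orbit_dist_orbit[OF assms(3)])
  have d_le: "d x y \<le> norm (x - U g y)" if "g \<in> carrier G" for x y g
    using fin that by (simp add: d_eq)
  have d_attained: "\<exists>g\<in>carrier G. d x y = norm (x - U g y)" for x y
    unfolding d_eq using Min_in[of "(\<lambda>g. norm (x - U g y)) ` carrier G"] fin ne by fastforce
  have \<Phi>_hat: "\<Phi> x = max_filter_bank_hat G U w (orbit G U x)" for x
    unfolding \<Phi>_def by (rule max_filter_bank_hat_orbit[OF assms(3), symmetric])
  have orbit_translate: "orbit G U (U g y) = orbit G U y" if g: "g \<in> carrier G" for g y
  proof -
    have "U h (U g y) = U (h \<otimes>\<^bsub>G\<^esub> g) y" if "h \<in> carrier G" for h
      using U_mult[OF that g] by simp
    moreover have "U h y = U (h \<otimes>\<^bsub>G\<^esub> inv\<^bsub>G\<^esub> g) (U g y)" if "h \<in> carrier G" for h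
      using U_mult[of "h \<otimes>\<^bsub>G\<^esub> inv\<^bsub>G\<^esub> g" g y] that g by (simp add: G.m_assoc del: hom_mult)
    ultimately show ?thesis
      unfolding orbit_def using g by (blast intro: G.inv_closed G.m_closed)
  qed
  have same_orbit: "\<exists>g\<in>carrier G. x = U g y" if "\<Phi> x = \<Phi> y" for x y
  proof -
    have "orbit G U x = orbit G U y"
      using assms(4) that unfolding \<Phi>_hat by (auto simp: orbits_def dest: inj_onD)
    moreover have "x \<in> orbit G U x"
      unfolding orbit_def using U_one[of x] G.one_closed by force
    ultimately show ?thesis
      by (auto simp: orbit_def)
  qed
  obtain C where C: "C > 0"
      "\<And>x y. \<exists>x' y'. \<Phi> x' = \<Phi> y' \<and> norm ((x, y) - (x', y')) \<le> C * norm (\<Phi> x - \<Phi> y)"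
    using max_filter_bank_diff_error_bound[OF fin ne, where U = U and w = w] unfolding \<Phi>_def by blast
  have lower: "1 / (2 * C) * d x y \<le> norm (\<Phi> x - \<Phi> y)" for x y
  proof -
    obtain x' y' where near: "\<Phi> x' = \<Phi> y'" "norm ((x, y) - (x', y')) \<le> C * norm (\<Phi> x - \<Phi> y)"
      using C(2) by blast
    obtain g where g: "g \<in> carrier G" "x' = U g y'"
      using same_orbit[OF near(1)] by blast
    have "d x y \<le> norm ((x - x') + U g (y' - y))"
      using d_le[OF g(1), of x y] g(2) linear_diff[OF orthogonal_transformation_linear[OF U[OF g(1)]]]
      by simp
    also have "\<dots> \<le> norm (x - x') + norm (y' - y)"
      using norm_triangle_ineq orthogonal_transformation_norm[OF U[OF g(1)]] by metis
    also have "\<dots> \<le> 2 * norm ((x, y) - (x', y'))"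
      using norm_fst_le[of "x - x'" "y - y'"] norm_snd_le[of "y - y'" "x - x'"]
      by (simp add: norm_minus_commute)
    finally have "d x y \<le> 2 * C * norm (\<Phi> x - \<Phi> y)"
      using near(2) by simp
    then show ?thesis
      using C(1) by (simp add: field_simps)
  qed
  define B where "B = (\<Sum>k\<in>UNIV. norm (w $ k))"
  have upper: "norm (\<Phi> x - \<Phi> y) \<le> B * d x y" for x y
  proof -
    obtain g where g: "g \<in> carrier G" "d x y = norm (x - U g y)"
      using d_attained by blast
    have "\<Phi> y = \<Phi> (U g y)"
      by (simp add: \<Phi>_hat orbit_translate[OF g(1)])
    then show ?thesis
      using max_filter_bank_lipschitz[OF fin ne U, where w = w and x = x and y = "U g y"] g(2) by (simp add: \<Phi>_def B_def)
  qed
  have "0 \<le> d x y" for x y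
    using d_attained[of x y] by auto
  then have "norm (\<Phi> x - \<Phi> y) \<le> max (1 / (2 * C)) B * d x y" for x y
    using upper[of x y] mult_right_mono[of B "max (1 / (2 * C)) B" "d x y"] by fastforce
  then show ?thesis
    using lower C(1) unfolding \<Phi>_def d_def
    by (intro exI[of _ "1 / (2 * C)"] exI[of _ "max (1 / (2 * C)) B"]) auto
qed

end
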